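(* Let $\mathbf v$ be a binary (over $\{0,1\}$) aperiodic uniformly recurrent sequence whose language is closed under the letter exchange $E$. Denote $\mathbf u=\mathcal S(\mathbf v)$ and $$A_1=\Bigl\{\mathrm{ind}_{\mathbf u}(u)+\tfrac1{|u|} : u \text{ is a stable return word to a bispecial factor of } \mathbf u\Bigr\},$$ $$A_2=\Bigl\{\tfrac12\bigl(\mathrm{ind}_{\mathbf u}(u)+\tfrac1{|u|}\bigr) : u \text{ is an unstable return word to a bispecial factor of } \mathbf u\Bigr\}.$$ Then $\mathrm{cr}(\mathbf v)=\sup(A_1\cup A_2)$.
   Context: $\mathbb N=\{0,1,2,\dots\}$. A sequence is a right-infinite word $\mathbf u=u_0u_1u_2\cdots$; its language $\mathcal L(\mathbf u)$ is the set of its finite factors (including the empty word $\varepsilon$). It is aperiodic if it is not eventually periodic, and uniformly recurrent if every factor occurs infinitely often with bounded distances between consecutive occurrences. A factor $w$ is right special if $wa,wb\in\mathcal L(\mathbf u)$ for two distinct letters $a,b$; left special is defined symmetrically; bispecial means both left and right special. If $i<j$ are two consecutive occurrences of a factor $w$ in $\mathbf u$, then $u_iu_{i+1}\cdots u_{j-1}$ is a return word to $w$ in $\mathbf u$. A word $z$ has fractional root $u\neq\varepsilon$ and exponent $e=|z|/|u|$ if $z$ is a prefix of $u^\omega=uuu\cdots$; we write $z=u^e$. The index of a non-empty factor $u$ in $\mathbf u$ is $\mathrm{ind}_{\mathbf u}(u)=\sup\{e\in\mathbb Q: u^e\in\mathcal L(\mathbf u)\}$, and the critical exponent is $\mathrm{cr}(\mathbf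 u)=\sup\{\mathrm{ind}_{\mathbf u}(u): u \text{ a non-empty factor of }\mathbf u\}$ (possibly $+\infty$). $E$ is the morphism exchanging the letters $0\leftrightarrow1$; $\mathcal L(\mathbf v)$ is closed under $E$ if $E(w)\in\mathcal L(\mathbf v)$ for all $w\in\mathcal L(\mathbf v)$. For a binary sequence $\mathbf v=v_0v_1\cdots$, $\mathcal S(\mathbf v)=u_0u_1\cdots$ with $u_i=v_i+v_{i+1}\bmod 2$ for all $i\in\mathbb N$. A word $u\in\{0,1\}^*$ is stable if the number $|u|_1$ of letters $1$ in $u$ is even, and unstable otherwise. *)

theory Defs
  imports Complex_Main "HOL-Library.Extended_Real" "HOL-Library.Omega_Words_Fun" "HOL-Library.Z2"
begin

definition language :: "'a word \<Rightarrow> 'a list set" where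
  "language u = {u [i \<rightarrow> j] |i j. i \<le> j}"

definition eventually_periodic :: "'a word \<Rightarrow> bool" where
  "eventually_periodic u \<longleftrightarrow> (\<exists>x y. y \<noteq> [] \<and> u = x \<frown> y\<^sup>\<omega>)"

definition aperiodic :: "'a word \<Rightarrow> bool" where
  "aperiodic u \<longleftrightarrow> \<not> eventually_periodic u"

definition occurrences :: "'a word \<Rightarrow> 'a list \<Rightarrow> nat set" where
  "occurrences u w = {i. u [i \<rightarrow> i + length w] = w}"

definition consecutive_occurrences :: "'a word \<Rightarrow> 'a list \<Rightarrow> nat \<Rightarrow> nat \<Rightarrow> bool" where
  "consecutive_occurrences u w i j \<longleftrightarrow>
     i < j \<and> i \<in> occurrences u w \<and> j \<in> occurrences u w \<and>
     (\<forall>k. i < k \<and> k < j \<longrightarrow> k \<notin> occurrences u w)"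

definition uniformly_recurrent :: "'a word \<Rightarrow> bool" where
  "uniformly_recurrent u \<longleftrightarrow>
     (\<forall>w \<in> language u. infinite (occurrences u w) \<and>
        (\<exists>B. \<forall>i j. consecutive_occurrences u w i j \<longrightarrow> j - i \<le> B))"

definition right_special :: "'a word \<Rightarrow> 'a list \<Rightarrow> bool" where
  "right_special u w \<longleftrightarrow> (\<exists>a b. a \<noteq> b \<and> w @ [a] \<in> language u \<and> w @ [b] \<in> language u)"

definition left_special :: "'a word \<Rightarrow> 'a list \<Rightarrow> bool" where
  "left_special u w \<longleftrightarrow> (\<exists>a b. a \<noteq> b \<and> a # w \<in> language u \<and> b # w \<in> language u)"

definition bispecial :: "'a word \<Rightarrow> 'a list \<Rightarrow> bool" where
  "bispecial u w \<longleftrightarrow> left_special u w \<and> right_special u w"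

definition return_word :: "'a word \<Rightarrow> 'a list \<Rightarrow> 'a list \<Rightarrow> bool" where
  "return_word u w r \<longleftrightarrow> (\<exists>i j. consecutive_occurrences u w i j \<and> r = u [i \<rightarrow> j])"

definition is_power :: "'a list \<Rightarrow> 'a list \<Rightarrow> real \<Rightarrow> bool" where
  "is_power z w e \<longleftrightarrow>
     w \<noteq> [] \<and> z = prefix (length z) (w\<^sup>\<omega>) \<and> e = real (length z) / real (length w)"

definition word_index :: "'a word \<Rightarrow> 'a list \<Rightarrow> ereal" where
  "word_index u w = Sup {ereal e |e. e \<in> \<rat> \<and> (\<exists>z \<in> language u. is_power z w e)}"

definition critical_exponent :: "'a word \<Rightarrow> ereal" where
  "critical_exponent u = Sup {word_index u w |w. w \<in> language u \<and> w \<noteq> []}"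

definition exchange :: "bit \<Rightarrow> bit" where
  "exchange a = (if a = 0 then 1 else 0)"

definition closed_under_exchange :: "bit word \<Rightarrow> bool" where
  "closed_under_exchange v \<longleftrightarrow> (\<forall>w \<in> language v. map exchange w \<in> language v)"

(* Addition on type bit is addition modulo 2. *)
definition sum_word :: "bit word \<Rightarrow> bit word" where
  "sum_word v = (\<lambda>i. v i + v (i + 1))"

definition stable_word :: "bit list \<Rightarrow> bool" where
  "stable_word w \<longleftrightarrow> even (count_list w 1)"

end

theory Submission
  imports Defs
begin

text \<open>
  A factor of \<open>v\<close> of length \<open>n + 1\<close> and period \<open>p\<close> with \<open>p \<le> n\<close> corresponds to a factor of
  \<open>u = \<S>(v)\<close> of length \<open>n\<close> and period \<open>p\<close> whose root is stable; an unstable root of length \<open>p\<close>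
  yields the period \<open>2p\<close> in \<open>v\<close>. This gives the bound from below. For the bound from above,
  exponents up to 2 are covered by the return word 0 to the empty word. For a larger exponent take
  a factor of \<open>v\<close> of period \<open>p\<close> that is as long as possible, and let \<open>b\<close> be the associated
  factor of \<open>u\<close> with its last \<open>p\<close> letters removed. By maximality \<open>b\<close> is bispecial, and by the
  theorem of Fine and Wilf the distance from its occurrence to the next one is a period of the whole
  factor and divides \<open>p\<close>.
\<close>

section \<open>Periodic runs and the theorem of Fine and Wilf\<close>

definition periodic_run :: "'a word \<Rightarrow> nat \<Rightarrow> nat \<Rightarrow> nat \<Rightarrow> bool" where
  "periodic_run f i n p \<longleftrightarrow> (\<forall>k. k + p < n \<longrightarrow> f (i + k) = f (i + k + p))"

abbreviation factor :: "'a word \<Rightarrow> nat \<Rightarrow> nat \<Rightarrow> 'a list" where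
  "factor f i n \<equiv> subsequence f i (i + n)"

lemma periodic_runD: "periodic_run f i n p \<Longrightarrow> k + p < n \<Longrightarrow> f (i + k) = f (i + k + p)"
  unfolding periodic_run_def by blast

lemma periodic_run_mono: "periodic_run f i n p \<Longrightarrow> m \<le> n \<Longrightarrow> periodic_run f i m p"
  unfolding periodic_run_def by auto

lemma periodic_run_shift:
  assumes "\<And>k. k < n \<Longrightarrow> f (i + k) = f (j + k)"
  shows "periodic_run f i n p \<longleftrightarrow> periodic_run f j n p"
  unfolding periodic_run_def
proof (intro all_cong1 imp_cong refl)
  fix k assume "k + p < n"
  then have "f (i + k) = f (j + k)" "f (i + (k + p)) = f (j + (k + p))"
    using assms by auto
  then show "f (i + k) = f (i + k + p) \<longleftrightarrow> f (j + k) = f (j + k + p)"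
    by (simp add: add.assoc)
qed

lemma periodic_run_mod:
  assumes "periodic_run f i n p" "p > 0" "k < n"
  shows "f (i + k) = f (i + k mod p)"
  using assms(3)
proof (induction k rule: less_induct)
  case (less k)
  show ?case
  proof (cases "k < p")
    case False
    then have "f (i + (k - p)) = f (i + k)"
      using periodic_runD[OF assms(1), of "k - p"] less.prems by (simp add: add.assoc)
    moreover have "f (i + (k - p)) = f (i + (k - p) mod p)"
      using less.IH[of "k - p"] less.prems assms(2) False by simp
    ultimately show ?thesis
      using False by (simp add: le_mod_geq)
  qed simp
qed

text \<open>Shifting by \<open>p - q\<close> means going back by \<open>q\<close> and then forward
  by \<open>p\<close>. When \<open>k < q\<close> there is no room to go back first, so the two moves
  are swapped; \<open>p + q \<le> n\<close> keeps \<open>k + p\<close> inside the run.\<close>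

lemma periodic_run_diff:
  assumes p: "periodic_run f i n p" and q: "periodic_run f i n q" and "q < p" "p + q \<le> n"
  shows "periodic_run f i n (p - q)"
  unfolding periodic_run_def
proof (intro allI impI)
  fix k assume k: "k + (p - q) < n"
  show "f (i + k) = f (i + k + (p - q))"
  proof (cases "q \<le> k")
    case True
    then have "f (i + (k - q)) = f (i + k)"
      using periodic_runD[OF q, of "k - q"] k \<open>q < p\<close> by (simp add: add.assoc)
    moreover have "f (i + (k - q)) = f (i + (k - q) + p)"
      using periodic_runD[OF p, of "k - q"] k True \<open>q < p\<close> by simp
    moreover have "i + (k - q) + p = i + k + (p - q)"
      using True \<open>q < p\<close> by simp
    ultimately show ?thesis by simp
  next
    case False
    then have "f (i + k) = f (i + k + p)"
      using periodic_runD[OF p, of k] assms(4) by simp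
    moreover have "f (i + (k + (p - q))) = f (i + (k + (p - q)) + q)"
      using periodic_runD[OF q, of "k + (p - q)"] False assms(3,4) by simp
    moreover have "i + (k + (p - q)) + q = i + k + p"
      using \<open>q < p\<close> by simp
    ultimately show ?thesis by (simp add: add.assoc)
  qed
qed

text \<open>Subtractive Euclidean algorithm: replacing the larger period by the difference preserves
  the gcd and only lowers \<open>p + q\<close>, so the length condition survives.\<close>

lemma fine_wilf:
  assumes "periodic_run f i n p" "periodic_run f i n q" "p > 0" "q > 0" "p + q \<le> n"
  shows "periodic_run f i n (gcd p q)"
  using assms
proof (induction "p + q" arbitrary: p q rule: less_induct)
  case less
  consider "p = q" | "q < p" | "p < q" by linarith
  then show ?case
  proof cases
    case 1
    then show ?thesis using less.prems by simp
  next
    case 2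
    then have "periodic_run f i n (gcd (p - q) q)"
      using less.prems periodic_run_diff[of f i n p q] by (intro less.hyps) auto
    then show ?thesis using 2 by (simp add: gcd_diff1_nat)
  next
    case 3
    then have "periodic_run f i n (gcd p (q - p))"
      using less.prems periodic_run_diff[of f i n q p] by (intro less.hyps) auto
    then show ?thesis using 3 by (metis gcd.commute gcd_diff1_nat less_imp_le)
  qed
qed

text \<open>A comparison at distance \<open>d\<close> is moved left by multiples of \<open>p\<close>
  until both positions lie in the prefix of length \<open>m\<close>. While \<open>k + d\<close> is
  beyond the prefix, \<open>p + d \<le> m\<close> forces \<open>p \<le> k\<close>, so the move stays
  inside the run.\<close>

lemma periodic_run_extend:
  assumes p: "periodic_run f i n p" and d: "periodic_run f i m d"
    and "p > 0" "p + d \<le> m"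
  shows "periodic_run f i n d"
proof -
  have "f (i + k) = f (i + k + d)" if "k + d < n" for k
    using that
  proof (induction k rule: less_induct)
    case (less k)
    show ?case
    proof (cases "k + d < m")
      case True
      then show ?thesis using periodic_runD[OF d] by blast
    next
      case False
      then have k: "p \<le> k" using \<open>p + d \<le> m\<close> by simp
      have "f (i + (k - p)) = f (i + (k - p) + d)"
        using less.IH[of "k - p"] less.prems k \<open>p > 0\<close> by simp
      moreover have "f (i + (k - p)) = f (i + (k - p) + p)"
        using periodic_runD[OF p, of "k - p"] less.prems k by simp
      moreover have "f (i + (k - p + d)) = f (i + (k - p + d) + p)"
        using periodic_runD[OF p, of "k - p + d"] less.prems k by simp
      moreover have "i + (k - p) + p = i + k" "i + (k - p + d) + p = i + k + d"
        using k by simp_all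
      ultimately show ?thesis by (simp add: add.assoc)
    qed
  qed
  then show ?thesis unfolding periodic_run_def by blast
qed

section \<open>Factors, fractional powers and indices in terms of periodic runs\<close>

lemma factor_Suc: "factor f i (Suc n) = factor f i n @ [f (i + n)]"
  by (simp add: subsequence_def)

lemma factor_Suc_left: "factor f i (Suc n) = f i # factor f (Suc i) n"
  by (simp add: subsequence_def upt_rec)

lemma factor_eq_iff:
  "factor f i n = factor g j n \<longleftrightarrow> (\<forall>k<n. f (i + k) = g (j + k))"
  by (auto simp: list_eq_iff_nth_eq)

lemma occurrences_factor:
  "j \<in> occurrences f (factor f i n) \<longleftrightarrow> (\<forall>k<n. f (j + k) = f (i + k))"
  unfolding occurrences_def by (simp add: factor_eq_iff)

lemma factor_in_language [intro]: "factor f i n \<in> language f"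
  unfolding language_def by (blast intro: le_add1)

lemma in_language_cases:
  assumes "w \<in> language f"
  obtains i where "w = factor f i (length w)"
proof -
  from assms obtain i j where "w = f [i \<rightarrow> j]" "i \<le> j"
    unfolding language_def by blast
  then have "w = factor f i (length w)" by simp
  then show thesis by (rule that)
qed

lemma singleton_in_language: "[f i] \<in> language f"
  using factor_in_language[of f i 1] by simp

lemma is_power_factor_iff:
  "is_power (factor f i n) w e \<longleftrightarrow>
     w \<noteq> [] \<and> (\<forall>k<n. f (i + k) = w ! (k mod length w)) \<and> e = real n / real (length w)"
proof -
  have "factor f i n = prefix n (w\<^sup>\<omega>) \<longleftrightarrow> (\<forall>k<n. f (i + k) = (w\<^sup>\<omega>) k)"
    using factor_eq_iff[of f i n "w\<^sup>\<omega>" 0] by (simp only: add_0)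
  moreover have "(w\<^sup>\<omega>) k = w ! (k mod length w)" if "w \<noteq> []" for k
    using that by simp
  moreover have "length (factor f i n) = n" by simp
  ultimately show ?thesis unfolding is_power_def by metis
qed

lemma is_powerI_periodic_run:
  assumes "periodic_run f i n p" "p > 0" "p \<le> n"
  shows "is_power (factor f i n) (factor f i p) (real n / real p)"
proof -
  have "f (i + k) = factor f i p ! (k mod p)" if "k < n" for k
    using periodic_run_mod[OF assms(1,2) that] assms(2) by simp
  then show ?thesis using assms by (simp add: is_power_factor_iff)
qed

lemma periodic_run_of_is_power:
  assumes "is_power (factor f i n) w e"
  shows "periodic_run f i n (length w)"
  using assms unfolding is_power_factor_iff periodic_run_def
  by (metis add.assoc add_lessD1 mod_add_self2)

text \<open>Once a full period is visible, the root itself is read off from the sequence; this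
  allows its stability to be decided by two letters of \<open>v\<close>.\<close>

lemma is_power_root:
  assumes "is_power (factor f i n) w e" "length w \<le> n"
  shows "w = factor f i (length w)"
proof (rule nth_equalityI)
  fix k assume "k < length w"
  then have "f (i + k) = w ! (k mod length w)"
    using assms unfolding is_power_factor_iff by auto
  with \<open>k < length w\<close> show "w ! k = factor f i (length w) ! k" by simp
qed simp

lemma word_index_ge:
  assumes "periodic_run f i n p" "p > 0" "p \<le> n"
  shows "ereal (real n / real p) \<le> word_index f (factor f i p)"
  unfolding word_index_def
  using is_powerI_periodic_run[OF assms]
  by (intro Sup_upper) (auto simp: Rats_divide)

lemma critical_exponent_ge:
  assumes "periodic_run f i n p" "p > 0" "p \<le> n"
  shows "ereal (real n / real p) \<le> critical_exponent f"
proof -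
  have "word_index f (factor f i p) \<le> critical_exponent f"
    unfolding critical_exponent_def using assms(2) by (intro Sup_upper) auto
  with word_index_ge[OF assms] show ?thesis by (rule order_trans)
qed

lemma critical_exponent_ge_one: "1 \<le> critical_exponent f"
  \<comment> \<open>A single letter is vacuously a run of period 1.\<close>
  using critical_exponent_ge[of f 0 1 1] by (simp add: periodic_run_def flip: one_ereal_def)

lemma word_index_le:
  assumes "r \<noteq> []"
    and "\<And>i n. is_power (factor f i n) r (real n / real (length r)) \<Longrightarrow>
           ereal (real n / real (length r)) \<le> X"
  shows "word_index f r \<le> X"
  unfolding word_index_def
proof (rule Sup_least, clarify)
  fix e z assume z: "z \<in> language f" and pow: "is_power z r e"
  from z obtain i where "z = factor f i (length z)" by (rule in_language_cases)
  moreover have "e = real (length z) / real (length r)"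
    using pow by (simp add: is_power_def)
  ultimately show "ereal e \<le> X" using assms(2) pow by metis
qed

section \<open>Bounded and maximal runs in aperiodic uniformly recurrent sequences\<close>

lemma eventually_periodicI:
  assumes "p > 0" "\<And>k. f (k + p) = f (k :: nat)"
  shows "eventually_periodic f"
proof -
  have "f k = (factor f 0 p)\<^sup>\<omega> k" for k
    using periodic_run_mod[of f 0 "Suc k" p k] assms by (simp add: periodic_run_def)
  then have "f = [] \<frown> (factor f 0 p)\<^sup>\<omega>" by auto
  then show ?thesis
    unfolding eventually_periodic_def using assms(1)
    by (intro exI[of _ "[]"] exI[of _ "factor f 0 p"]) simp
qed

text \<open>If runs of period \<open>p\<close> were arbitrarily long, bounded gaps would place every
  factor of length \<open>p + 1\<close> inside one of them. Its first and last letters would then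
  agree, making the whole sequence periodic.\<close>

lemma bounded_periodic_runs:
  assumes "aperiodic f" "uniformly_recurrent f" "p > 0"
  shows "\<exists>N. \<forall>i n. periodic_run f i n p \<longrightarrow> n \<le> N"
proof (rule ccontr)
  assume "\<not> ?thesis"
  then have long: "\<exists>i n. periodic_run f i n p \<and> N < n" for N by (meson not_le)
  have "f (k + p) = f k" for k
  proof -
    let ?w = "factor f k (p + 1)"
    have "?w \<in> language f" by (rule factor_in_language)
    then obtain B where inf: "infinite (occurrences f ?w)"
      and B: "\<And>i j. consecutive_occurrences f ?w i j \<Longrightarrow> j - i \<le> B"
      using assms(2) unfolding uniformly_recurrent_def by blast
    \<comment> \<open>The length serves both cases below. If \<open>i \<le> k\<close>, the
      occurrence at \<open>k\<close> already lies in the run; otherwise some occurrence precedes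
      \<open>i\<close>, and the first one from \<open>i\<close> on is at most \<open>B\<close> after
      the last of these.\<close>
    from long obtain i n where run: "periodic_run f i n p" and n: "k + B + p < n" by blast
    have k: "k \<in> occurrences f ?w" by (simp only: occurrences_factor) simp
    have "\<exists>j \<in> occurrences f ?w. i \<le> j \<and> j + p < i + n"
    proof (cases "i \<le> k")
      case True
      then show ?thesis using k n by (intro bexI[of _ k]) auto
    next
      case False
      let ?next = "\<lambda>j. j \<in> occurrences f ?w \<and> i \<le> j"
      define j where "j = (LEAST j. ?next j)"
      have "\<exists>j. ?next j" using inf by (meson infinite_nat_iff_unbounded_le)
      then have j: "?next j" unfolding j_def by (rule LeastI_ex)
      have jmin: "j \<le> l" if "?next l" for l unfolding j_def using that by (rule Least_le)
      let ?prev = "{l \<in> occurrences f ?w. l < i}"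
      define m where "m = Max ?prev"
      have fin: "finite ?prev" by simp
      have "m \<in> ?prev" unfolding m_def using fin k False by (intro Max_in) auto
      moreover have "l \<le> m" if "l \<in> ?prev" for l unfolding m_def using fin that by simp
      ultimately have "consecutive_occurrences f ?w m j"
        unfolding consecutive_occurrences_def using j jmin
        by (smt (verit, ccfv_threshold) leD le_less_linear mem_Collect_eq order.strict_trans1)
      then have "j - m \<le> B" by (rule B)
      with \<open>m \<in> ?prev\<close> j n show ?thesis by (intro bexI[of _ j]) auto
    qed
    then obtain j where j: "j \<in> occurrences f ?w" "i \<le> j" "j + p < i + n" by blast
    have "f (i + (j - i)) = f (i + (j - i) + p)"
      using periodic_runD[OF run, of "j - i"] j by simp
    then have "f j = f (j + p)" using j by simp
    moreover from j(1) have "\<forall>l<p + 1. f (j + l) = f (k + l)"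
      by (simp only: occurrences_factor)
    then have "f (j + 0) = f (k + 0)" "f (j + p) = f (k + p)"
      using add_gr_0 less_add_one zero_less_one by blast+
    ultimately show ?thesis by simp
  qed
  with assms(1,3) show False unfolding aperiodic_def using eventually_periodicI by blast
qed

text \<open>The length is maximal among runs of period \<open>p\<close> at all positions, so a
  one-letter extension on either side is impossible.\<close>

lemma maximal_periodic_run:
  assumes "aperiodic f" "uniformly_recurrent f" "p > 0" "periodic_run f i n p" "p \<le> n"
  obtains j m where "n \<le> m" "periodic_run f (Suc j) m p"
    "f (Suc j + m) \<noteq> f (Suc j + m - p)" "f j \<noteq> f (j + p)"
proof -
  let ?P = "\<lambda>m. n \<le> m \<and> (\<exists>i. periodic_run f i m p)"
  obtain N where N: "\<And>i n. periodic_run f i n p \<Longrightarrow> n \<le> N"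
    using bounded_periodic_runs[OF assms(1-3)] by blast
  define m where "m = (GREATEST m. ?P m)"
  have m: "?P m" unfolding m_def by (rule GreatestI_nat[of ?P n N]) (use assms(4) N in auto)
  have max: "\<not> periodic_run f l (Suc m) p" for l
  proof
    assume "periodic_run f l (Suc m) p"
    then have "Suc m \<le> m" unfolding m_def
      by (intro Greatest_le_nat[of ?P _ N]) (use m N in \<open>auto simp: m_def\<close>)
    then show False by simp
  qed
  from m obtain i where i: "periodic_run f i m p" by blast
  have "infinite (occurrences f (factor f i m))"
    using assms(2) unfolding uniformly_recurrent_def by blast
  \<comment> \<open>Recurrence moves the run away from position 0, so that a letter to its left
    exists.\<close>
  then obtain l where l: "l > 0" "l \<in> occurrences f (factor f i m)"
    by (meson infinite_nat_iff_unbounded)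
  obtain j where j: "l = Suc j" using l(1) by (cases l) auto
  have run: "periodic_run f (Suc j) m p"
    using i periodic_run_shift[of m f i l p] l(2) j by (simp add: occurrences_factor)
  have right: "f (Suc j + m) \<noteq> f (Suc j + m - p)"
  proof
    assume eq: "f (Suc j + m) = f (Suc j + m - p)"
    have "periodic_run f (Suc j) (Suc m) p"
      unfolding periodic_run_def
    proof (intro allI impI)
      fix k assume "k + p < Suc m"
      then consider "k + p < m" | "k = m - p" "k + p = m" by linarith
      then show "f (Suc j + k) = f (Suc j + k + p)"
      proof cases
        case 1
        then show ?thesis using periodic_runD[OF run] by blast
      next
        case 2
        then have "Suc j + k = Suc j + m - p" "Suc j + k + p = Suc j + m" by linarith+
        then show ?thesis using eq by simp
      qed
    qed
    then show False using max by blast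
  qed
  have left: "f j \<noteq> f (j + p)"
  proof
    assume eq: "f j = f (j + p)"
    have "periodic_run f j (Suc m) p"
      unfolding periodic_run_def
    proof (intro allI impI)
      fix k assume "k + p < Suc m"
      then show "f (j + k) = f (j + k + p)"
        using eq periodic_runD[OF run, of "k - 1"] by (cases k) auto
    qed
    then show False using max by blast
  qed
  show ?thesis using that m run right left by blast
qed

section \<open>Transfer of periods between \<open>v\<close> and \<open>sum_word v\<close>\<close>

lemma bit_add_eq_add_iff: "(a :: bit) + b = c + d \<longleftrightarrow> (a = c \<longleftrightarrow> b = d)"
  by (cases a; cases b; cases c; cases d) simp_all

lemma sum_word_eq_iff:
  "sum_word v i = sum_word v j \<longleftrightarrow> (v i = v j \<longleftrightarrow> v (Suc i) = v (Suc j))"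
  unfolding sum_word_def by (simp only: bit_add_eq_add_iff Suc_eq_plus1)

lemma bit_add_eq_one_iff: "(a :: bit) + b = 1 \<longleftrightarrow> a \<noteq> b"
  by (cases a; cases b) simp_all

text \<open>Over two letters, two changes cancel. This is why an unstable root doubles its period in
  \<open>v\<close>.\<close>

lemma bit_eq_iff_via: "(a :: bit) = c \<longleftrightarrow> (a = b \<longleftrightarrow> b = c)"
  by (cases a; cases b; cases c) simp_all

text \<open>The letters 1 of \<open>sum_word v\<close> mark the changes of letter in
  \<open>v\<close>; an even number of changes restores the initial letter.\<close>

lemma stable_word_sum_word: "stable_word (factor (sum_word v) i p) \<longleftrightarrow> v i = v (i + p)"
proof (induction p)
  case 0
  then show ?case by (simp add: stable_word_def subsequence_def)
next
  case (Suc p)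
  have "factor (sum_word v) i (Suc p) = factor (sum_word v) i p @ [v (i + p) + v (i + Suc p)]"
    by (simp add: factor_Suc sum_word_def)
  moreover have "v (i + p) + v (i + Suc p) = 1 \<longleftrightarrow> v (i + p) \<noteq> v (i + Suc p)"
    by (simp only: bit_add_eq_one_iff)
  ultimately have "stable_word (factor (sum_word v) i (Suc p)) \<longleftrightarrow>
      (stable_word (factor (sum_word v) i p) \<longleftrightarrow> v (i + p) = v (i + Suc p))"
    unfolding stable_word_def by simp
  then show ?case using Suc bit_eq_iff_via[of "v i" "v (i + Suc p)" "v (i + p)"] by blast
qed

text \<open>Equal letters of \<open>sum_word v\<close> at distance \<open>p\<close> carry agreement
  or disagreement of \<open>v\<close> at that distance one position further. The bound is
  \<open>k + p \<le> n\<close>, not strict, because a factor of length \<open>n\<close> of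
  \<open>sum_word v\<close> comes from \<open>n + 1\<close> letters of \<open>v\<close>.\<close>

lemma run_of_sum_word:
  assumes "periodic_run (sum_word v) i n p" "k + p \<le> n"
  shows "v (i + k) = v (i + k + p) \<longleftrightarrow> v i = v (i + p)"
  using assms(2)
proof (induction k)
  case (Suc k)
  have "sum_word v (i + k) = sum_word v (i + k + p)"
    using periodic_runD[OF assms(1)] Suc.prems by simp
  then have "v (i + k) = v (i + k + p) \<longleftrightarrow> v (i + Suc k) = v (i + Suc k + p)"
    by (simp only: sum_word_eq_iff add_Suc add_Suc_right)
  then show ?case using Suc by simp
qed simp

lemma lift_stable_run:
  assumes "periodic_run (sum_word v) i n p" "v i = v (i + p)"
  shows "periodic_run v i (Suc n) p"
  using run_of_sum_word[OF assms(1)] assms(2) unfolding periodic_run_def by (simp add: less_Suc_eq_le)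

text \<open>Here \<open>v\<close> is complemented by each shift by \<open>p\<close>, so two shifts
  restore it. This is the source of the factor 1/2 in the second set.\<close>

lemma lift_unstable_run:
  assumes "periodic_run (sum_word v) i n p" "v i \<noteq> v (i + p)"
  shows "periodic_run v i (Suc n) (2 * p)"
  unfolding periodic_run_def
proof (intro allI impI)
  fix k assume k: "k + 2 * p < Suc n"
  have "v (i + k) \<noteq> v (i + k + p)"
    using run_of_sum_word[OF assms(1), of k] k assms(2) by simp
  moreover have "v (i + (k + p)) \<noteq> v (i + (k + p) + p)"
    using run_of_sum_word[OF assms(1), of "k + p"] k assms(2) by simp
  ultimately show "v (i + k) = v (i + k + 2 * p)"
    using bit_eq_iff_via[of "v (i + k)" "v (i + k + 2 * p)" "v (i + k + p)"]
    by (simp add: add_ac mult_2)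
qed

lemma project_run:
  assumes "periodic_run v i (Suc n) p"
  shows "periodic_run (sum_word v) i n p"
  unfolding periodic_run_def sum_word_def
proof (intro allI impI)
  fix k assume "k + p < n"
  then show "v (i + k) + v (i + k + 1) = v (i + k + p) + v (i + k + p + 1)"
    using periodic_runD[OF assms, of k] periodic_runD[OF assms, of "Suc k"] by simp
qed

section \<open>Lower bound for the critical exponent\<close>

definition exponent_set :: "bit word \<Rightarrow> ereal set" where
  "exponent_set u =
     {word_index u r + ereal (1 / real (length r)) |r.
        stable_word r \<and> (\<exists>w. bispecial u w \<and> return_word u w r)} \<union>
     {ereal (1 / 2) * (word_index u r + ereal (1 / real (length r))) |r.
        \<not> stable_word r \<and> (\<exists>w. bispecial u w \<and> return_word u w r)}"

text \<open>A power of \<open>r\<close> of length \<open>n\<close> at least \<open>length r\<close>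
  lifts to \<open>v\<close> with the same period and one more letter, which raises its exponent by
  \<open>1 / length r\<close>.\<close>

lemma stable_index_le:
  assumes "stable_word r" "r \<noteq> []"
  shows "word_index (sum_word v) r + ereal (1 / real (length r)) \<le> critical_exponent v"
proof -
  let ?p = "length r"
  have "word_index (sum_word v) r \<le> critical_exponent v - ereal (1 / real ?p)"
  proof (rule word_index_le[OF assms(2)])
    fix i n assume pow: "is_power (factor (sum_word v) i n) r (real n / real ?p)"
    have "ereal (real (Suc n) / real ?p) \<le> critical_exponent v"
    proof (cases "?p \<le> n")
      case True
      have "v i = v (i + ?p)"
        using assms(1) is_power_root[OF pow True] stable_word_sum_word by metis
      then have "periodic_run v i (Suc n) ?p"
        using lift_stable_run periodic_run_of_is_power[OF pow] by blast
      then show ?thesis using True assms(2) by (intro critical_exponent_ge) auto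
    next
      \<comment> \<open>The power may be too short to determine \<open>r\<close>, but then
        \<open>Suc n \<le> length r\<close> and the trivial bound 1 suffices.\<close>
      case False
      then have "real (Suc n) / real ?p \<le> 1" using assms(2) by simp
      then have "ereal (real (Suc n) / real ?p) \<le> 1" by (simp only: one_ereal_def ereal_less_eq)
      then show ?thesis using critical_exponent_ge_one order_trans by blast
    qed
    then show "ereal (real n / real ?p) \<le> critical_exponent v - ereal (1 / real ?p)"
      by (simp add: ereal_le_minus add_divide_distrib add.commute)
  qed
  then show ?thesis by (simp add: ereal_le_minus)
qed

lemma unstable_index_le:
  assumes "\<not> stable_word r" "r \<noteq> []"
  shows "ereal (1 / 2) * (word_index (sum_word v) r + ereal (1 / real (length r)))
    \<le> critical_exponent v"
proof (cases "critical_exponent v")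
  \<comment> \<open>For a finite critical exponent the inequality is solved for the index; the value
    \<open>\<infinity>\<close> is trivial and \<open>-\<infinity>\<close> is excluded by the bound
    1.\<close>
  case (real x)
  let ?p = "length r" and ?W = "word_index (sum_word v) r"
  have "0 < ?p" using assms(2) by simp
  have "?W \<le> ereal (2 * x - 1 / real ?p)"
  proof (rule word_index_le[OF assms(2)])
    fix i n assume pow: "is_power (factor (sum_word v) i n) r (real n / real ?p)"
    have "ereal (real (Suc n) / real (2 * ?p)) \<le> critical_exponent v"
    proof (cases "2 * ?p \<le> n")
      case True
      then have "r = factor (sum_word v) i ?p" by (intro is_power_root[OF pow]) simp
      then have "v i \<noteq> v (i + ?p)"
        using assms(1) stable_word_sum_word by metis
      then have "periodic_run v i (Suc n) (2 * ?p)"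
        using lift_unstable_run periodic_run_of_is_power[OF pow] by blast
      then show ?thesis
        using True \<open>0 < ?p\<close> by (intro critical_exponent_ge) auto
    next
      case False
      then have "real (Suc n) / real (2 * ?p) \<le> 1" using assms(2) by simp
      then have "ereal (real (Suc n) / real (2 * ?p)) \<le> 1"
        by (simp only: one_ereal_def ereal_less_eq)
      then show ?thesis using critical_exponent_ge_one order_trans by blast
    qed
    then have "real (Suc n) / real (2 * ?p) \<le> x"
      unfolding real by (simp only: ereal_less_eq)
    then have "real n / real ?p \<le> 2 * x - 1 / real ?p"
      using \<open>0 < ?p\<close> by (simp add: field_simps)
    then show "ereal (real n / real ?p) \<le> ereal (2 * x - 1 / real ?p)"
      by (simp only: ereal_less_eq)
  qed
  then show ?thesis unfolding real by (cases ?W) auto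
next
  case MInf
  then show ?thesis using critical_exponent_ge_one[of v] by simp
qed simp

lemma Sup_exponent_set_le: "Sup (exponent_set (sum_word v)) \<le> critical_exponent v"
proof -
  have "r \<noteq> []" if "return_word u w r" for u :: "bit word" and w r
    using that unfolding return_word_def consecutive_occurrences_def by auto
  then show ?thesis
    unfolding exponent_set_def
    by (intro Sup_least) (use stable_index_le unstable_index_le in blast)
qed

section \<open>Upper bound for the critical exponent\<close>

lemma Sup_exponent_set_ge:
  assumes "bispecial (sum_word v) w" "return_word (sum_word v) w (factor (sum_word v) i q)"
    and "periodic_run (sum_word v) i n q" "0 < q" "q \<le> n"
  shows "v i = v (i + q) \<Longrightarrow> ereal (real (Suc n) / real q) \<le> Sup (exponent_set (sum_word v))"
    and "v i \<noteq> v (i + q) \<Longrightarrow>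
      ereal (real (Suc n) / real (2 * q)) \<le> Sup (exponent_set (sum_word v))"
proof -
  let ?u = "sum_word v" let ?r = "factor (sum_word v) i q"
  have "ereal (real n / real q) + ereal (1 / real q) \<le> word_index ?u ?r + ereal (1 / real q)"
    using word_index_ge[OF assms(3-5)] by (rule add_right_mono)
  then have ge: "ereal (real (Suc n) / real q) \<le> word_index ?u ?r + ereal (1 / real (length ?r))"
    by (simp add: add_divide_distrib add.commute)
  show "ereal (real (Suc n) / real q) \<le> Sup (exponent_set ?u)" if "v i = v (i + q)"
  proof -
    have "word_index ?u ?r + ereal (1 / real (length ?r)) \<in> exponent_set ?u"
      unfolding exponent_set_def using that assms(1,2) stable_word_sum_word by blast
    with ge show ?thesis by (meson Sup_upper order_trans)
  qed
  show "ereal (real (Suc n) / real (2 * q)) \<le> Sup (exponent_set ?u)" if "v i \<noteq> v (i + q)"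
  proof -
    have "ereal (1 / 2) * ereal (real (Suc n) / real q)
        \<le> ereal (1 / 2) * (word_index ?u ?r + ereal (1 / real (length ?r)))"
      using ge by (intro ereal_mult_left_mono) auto
    moreover have "ereal (1 / 2) * (word_index ?u ?r + ereal (1 / real (length ?r)))
        \<in> exponent_set ?u"
      unfolding exponent_set_def using that assms(1,2) stable_word_sum_word by blast
    moreover have "ereal (1 / 2) * ereal (real (Suc n) / real q)
        = ereal (real (Suc n) / real (2 * q))"
      by simp
    ultimately show ?thesis by (metis Sup_upper order_trans)
  qed
qed

text \<open>Were \<open>sum_word v\<close> constantly 0 or constantly 1, \<open>v\<close> would be
  constant or alternating. Hence both letters occur and the empty word is bispecial.\<close>

lemma two_le_Sup_exponent_set:
  assumes "aperiodic v"
  shows "2 \<le> Sup (exponent_set (sum_word v))"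
proof -
  let ?u = "sum_word v"
  have "\<exists>i. ?u i = 1"
  proof (rule ccontr)
    assume "\<nexists>i. ?u i = 1"
    then have "v (k + 1) = v k" for k
      by (metis bit_add_eq_one_iff sum_word_def)
    then show False using assms eventually_periodicI[of 1 v] unfolding aperiodic_def by simp
  qed
  then obtain j where j: "?u j = 1" by blast
  have "\<exists>i. ?u i = 0"
  proof (rule ccontr)
    assume nz: "\<nexists>i. ?u i = 0"
    have "v k \<noteq> v (k + 1)" for k
      using nz by (metis bit_add_eq_one_iff bit_not_zero_iff sum_word_def)
    then have "v (k + 2) = v k" for k
      using bit_eq_iff_via[of "v k" "v (k + 2)" "v (k + 1)"]
      by (metis add.assoc one_add_one)
    then show False using assms eventually_periodicI[of 2 v] unfolding aperiodic_def by simp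
  qed
  then obtain i where i: "?u i = 0" by blast
  have "[0] \<in> language ?u" "[1] \<in> language ?u"
    using singleton_in_language[of ?u i] singleton_in_language[of ?u j] i j by simp_all
  then have "bispecial ?u []"
    unfolding bispecial_def left_special_def right_special_def
    by (metis append_Nil zero_neq_one)
  \<comment> \<open>The empty word occurs at every position, so its return words are single
    letters.\<close>
  moreover have "return_word ?u [] (factor ?u i 1)"
    unfolding return_word_def consecutive_occurrences_def occurrences_def
    by (intro exI[of _ i] exI[of _ "i + 1"]) auto
  moreover have "v i = v (i + 1)"
    using i by (metis bit_add_eq_one_iff sum_word_def zero_neq_one)
  \<comment> \<open>The stable return word 0 has index at least 1, and the correction
    \<open>1 / length r\<close> adds another 1.\<close>
  ultimately have "ereal (real (Suc 1) / real 1) \<le> Sup (exponent_set ?u)"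
    by (intro Sup_exponent_set_ge(1)[of v "[]" i 1 1]) (auto simp: periodic_run_def)
  then show ?thesis by simp
qed

lemma long_run_le_Sup_exponent_set:
  assumes "aperiodic v" "uniformly_recurrent v"
    and "periodic_run v i' n' p" "0 < p" "2 * p < n'"
  shows "ereal (real n' / real p) \<le> Sup (exponent_set (sum_word v))"
proof -
  let ?u = "sum_word v"
  obtain j m where "n' \<le> m" and run: "periodic_run v (Suc j) m p"
    and right: "v (Suc j + m) \<noteq> v (Suc j + m - p)" and left: "v j \<noteq> v (j + p)"
    by (rule maximal_periodic_run[OF assms(1,2,4,3)]) (use assms(5) in simp_all)
  then obtain n where m: "m = Suc n" using assms(5) by (cases m) auto
  \<comment> \<open>The strict inequality \<open>2 * p < n'\<close> pays for the letter lost in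
    passing to \<open>sum_word v\<close>; it makes \<open>b\<close> at least \<open>p\<close>
    letters long, as Fine and Wilf will require.\<close>
  have n: "2 * p \<le> n" using m \<open>n' \<le> m\<close> assms(5) by simp
  define i where "i = Suc j"
  have vrun: "periodic_run v i (Suc n) p" using run m by (simp add: i_def)
  have urun: "periodic_run ?u i n p" using vrun by (rule project_run)
  define l where "l = n - p"
  have nl: "n = l + p" and "p \<le> l" using n by (simp_all add: l_def)
  define b where "b = factor ?u i l"
  have occ: "k \<in> occurrences ?u b \<longleftrightarrow> (\<forall>x<l. ?u (k + x) = ?u (i + x))" for k
    unfolding b_def by (rule occurrences_factor)
  have occ_p: "i + p \<in> occurrences ?u b"
    unfolding occ
  proof (intro allI impI)
    fix x assume "x < l"
    then show "?u (i + p + x) = ?u (i + x)"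
      using periodic_runD[OF urun, of x] nl by (simp add: add_ac)
  qed
  have b_p: "b = factor ?u (i + p) l"
    using occ_p unfolding occurrences_def b_def by simp
  have "bispecial ?u b"
    unfolding bispecial_def
  proof
    have "b @ [?u (i + l)] = factor ?u i (Suc l)"
      by (simp only: b_def factor_Suc)
    moreover have "b @ [?u (i + n)] = factor ?u (i + p) (Suc l)"
      unfolding b_p factor_Suc nl by (simp only: add_ac)
    \<comment> \<open>Of the two pairs of letters of \<open>v\<close> behind these sums, the first
      agrees by periodicity and the second differs by maximality. The left side is
      symmetric.\<close>
    moreover have "?u (i + l) \<noteq> ?u (i + n)"
    proof -
      have "v (i + l) = v (i + l + p)" using periodic_runD[OF vrun, of l] nl by simp
      moreover have "v (i + Suc l) \<noteq> v (i + Suc n)"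
        using right m nl by (simp add: i_def)
      ultimately show ?thesis
        using nl by (simp only: sum_word_eq_iff add_Suc_right add.assoc) simp
    qed
    ultimately show "right_special ?u b"
      unfolding right_special_def by (metis factor_in_language)
  next
    have "?u j # b = factor ?u j (Suc l)"
      by (simp only: b_def i_def factor_Suc_left)
    moreover have "?u (j + p) # b = factor ?u (j + p) (Suc l)"
      by (simp only: b_p i_def factor_Suc_left add_Suc)
    moreover have "?u j \<noteq> ?u (j + p)"
    proof -
      have "v (Suc j) = v (Suc j + p)" using periodic_runD[OF vrun, of 0] nl n by (simp add: i_def)
      then show ?thesis using left by (simp only: sum_word_eq_iff add_Suc) simp
    qed
    ultimately show "left_special ?u b"
      unfolding left_special_def by (metis factor_in_language)
  qed
  define q where "q = (LEAST q. 0 < q \<and> i + q \<in> occurrences ?u b)"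
  have q: "0 < q" "i + q \<in> occurrences ?u b"
    using LeastI[of "\<lambda>q. 0 < q \<and> i + q \<in> occurrences ?u b" p] occ_p assms(4)
    unfolding q_def by auto
  have qmin: "q \<le> k" if "0 < k" "i + k \<in> occurrences ?u b" for k
    unfolding q_def using that by (intro Least_le) simp
  have "q \<le> p" using qmin occ_p assms(4) by blast
  have ret: "return_word ?u b (factor ?u i q)"
  proof -
    have "k \<notin> occurrences ?u b" if "i < k" "k < i + q" for k
      using qmin[of "k - i"] that by auto
    then have "consecutive_occurrences ?u b i (i + q)"
      unfolding consecutive_occurrences_def using q occ[of i] by simp
    then show ?thesis unfolding return_word_def by blast
  qed
  \<comment> \<open>The occurrences of \<open>b\<close> at \<open>i\<close> and \<open>i + q\<close>
    together cover \<open>q + l\<close> letters, at least \<open>p + q\<close>, with period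
    \<open>q\<close>.\<close>
  have "periodic_run ?u i (q + l) q"
    unfolding periodic_run_def
  proof (intro allI impI)
    fix k assume "k + q < q + l"
    then have "k < l" by simp
    then have "?u (i + q + k) = ?u (i + k)" using q(2) unfolding occ by blast
    then show "?u (i + k) = ?u (i + k + q)" by (simp add: add_ac)
  qed
  moreover have "periodic_run ?u i (q + l) p"
    using urun by (rule periodic_run_mono) (use nl \<open>q \<le> p\<close> in simp)
  ultimately have "periodic_run ?u i (q + l) (gcd p q)"
    using assms(4) q(1) \<open>p \<le> l\<close> by (intro fine_wilf) simp_all
  moreover have "gcd p q \<le> q" using q(1) by (simp add: dvd_imp_le)
  ultimately have run_d: "periodic_run ?u i n (gcd p q)"
    using assms(4) \<open>p \<le> l\<close> by (intro periodic_run_extend[OF urun]) (assumption | linarith)+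
  \<comment> \<open>The period \<open>gcd p q\<close> of the whole factor yields an occurrence of
    \<open>b\<close> at that distance, so minimality of \<open>q\<close> forces
    \<open>gcd p q = q\<close>.\<close>
  have "i + gcd p q \<in> occurrences ?u b"
    unfolding occ
  proof (intro allI impI)
    fix x assume "x < l"
    moreover have "gcd p q \<le> p" using assms(4) by (simp add: dvd_imp_le)
    ultimately show "?u (i + gcd p q + x) = ?u (i + x)"
      using periodic_runD[OF run_d, of x] nl by (simp add: add_ac)
  qed
  then have "q \<le> gcd p q" using qmin q(1) by simp
  with \<open>gcd p q \<le> q\<close> have d: "gcd p q = q" by simp
  then have "q dvd p" by (metis gcd_dvd1)
  have run_q: "periodic_run ?u i n q" using run_d d by simp
  have "q \<le> n" using \<open>q \<le> p\<close> n by simp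
  note Sup_ge = Sup_exponent_set_ge[OF \<open>bispecial ?u b\<close> ret run_q q(1) \<open>q \<le> n\<close>]
  have target: "real n' / real p \<le> real (Suc n) / real c" if "0 < c" "c \<le> p" for c
    using that \<open>n' \<le> m\<close> m by (intro frac_le) auto
  show ?thesis
  proof (cases "v i = v (i + q)")
    case True
    then show ?thesis
      using Sup_ge(1) target[OF q(1) \<open>q \<le> p\<close>] by (meson ereal_less_eq(3) order_trans)
  next
    case False
    \<comment> \<open>A shift by \<open>p\<close> preserves the letter while a shift by
      \<open>q\<close> changes it, so \<open>q\<close> is a proper divisor of \<open>p\<close>.
      Hence the doubled period \<open>2 * q\<close> still does not exceed \<open>p\<close>.\<close>
    moreover have "v i = v (i + p)" using periodic_runD[OF vrun, of 0] n by simp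
    ultimately have "p \<noteq> q" by blast
    with \<open>q dvd p\<close> assms(4) have "2 * q \<le> p"
      by (elim dvdE) (metis One_nat_def Suc_lessI less_eq_Suc_le mult.commute mult_le_mono1
          mult_0_right mult_1_right nat_0_less_mult_iff numeral_2_eq_2)
    then show ?thesis
      using Sup_ge(2)[OF False] target[of "2 * q"] q(1)
      by (meson ereal_less_eq(3) nat_0_less_mult_iff order_trans zero_less_numeral)
  qed
qed

lemma critical_exponent_le:
  assumes "aperiodic v" "uniformly_recurrent v"
  shows "critical_exponent v \<le> Sup (exponent_set (sum_word v))"
  unfolding critical_exponent_def
proof (rule Sup_least, clarify)
  fix w assume "w \<in> language v" "w \<noteq> []"
  show "word_index v w \<le> Sup (exponent_set (sum_word v))"
  proof (rule word_index_le[OF \<open>w \<noteq> []\<close>])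
    fix i n assume pow: "is_power (factor v i n) w (real n / real (length w))"
    show "ereal (real n / real (length w)) \<le> Sup (exponent_set (sum_word v))"
    \<comment> \<open>Exponents above 2 come from long runs; the others are covered by the return
      word 0.\<close>
    proof (cases "2 * length w < n")
      case True
      then show ?thesis
        using long_run_le_Sup_exponent_set[OF assms periodic_run_of_is_power[OF pow]] \<open>w \<noteq> []\<close>
        by simp
    next
      case False
      then have "real n \<le> 2 * real (length w)" by linarith
      then have "ereal (real n / real (length w)) \<le> 2"
        using \<open>w \<noteq> []\<close> by (simp add: divide_le_eq)
      then show ?thesis using two_le_Sup_exponent_set[OF assms(1)] by (rule order_trans)
    qed
  qed
qed

theorem theorem14:
  fixes v :: "bit word"
  assumes "aperiodic v"
    and "uniformly_recurrent v"
    and "closed_under_exchange v"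
  shows "let u = sum_word v;
             A\<^sub>1 = {word_index u r + ereal (1 / real (length r)) |r.
                    stable_word r \<and> (\<exists>w. bispecial u w \<and> return_word u w r)};
             A\<^sub>2 = {ereal (1 / 2) * (word_index u r + ereal (1 / real (length r))) |r.
                    \<not> stable_word r \<and> (\<exists>w. bispecial u w \<and> return_word u w r)}
         in critical_exponent v = Sup (A\<^sub>1 \<union> A\<^sub>2)"
  using critical_exponent_le[OF assms(1,2)] Sup_exponent_set_le[of v]
  unfolding Let_def exponent_set_def by (rule antisym)

end
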